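(* Let $C\subset\mathbb{R}^d$ be nonempty, convex and compact with diameter $\Delta>0$, and let $f\colon\mathbb{R}^d\to\mathbb{R}$ be differentiable with $L$-Lipschitz continuous gradient. Let $\tau>0$ and $\sigma\in[0,1/3)$, and suppose that for every $\bar x\in C$ the estimate $\widetilde\nabla f(\bar x)\in\mathbb{R}^d$ of $\nabla f(\bar x)$ satisfies $$\bigl|(\nabla f(\bar x)-\widetilde\nabla f(\bar x))^\top(x-\bar x)\bigr|\le \frac{\sigma}{1+\sigma}\,\tau\qquad\text{for all }x,\bar x\in C .$$ Consider the Frank-Wolfe algorithm with inexact gradient (described in the context), started at $x_0\in C$ with tolerance $\tau$, and suppose that, for some fixed $\rho>0$, its step sizes $\eta_n$ satisfy $$\eta_n\ge\bar\eta_n:=\min\Bigl\{1,\frac{\tilde g_n}{L\|d_n\|^2}\Bigr\},\qquad f(x_n)-f(x_n+\eta_nd_n)\ge\rho\,\bar\eta_n\,\tilde g_n .$$ Then the algorithm terminates after a finite number of iterations; specifically, the index $N$ of its last iteration satisfies $$N\le\lceil\max\{\alpha_1,\alpha_2\}\rceil-1,\qquad \alpha_1=\frac{\Delta^2L\,(f(x_0)-f^* )(1+\sigma)^2}{\tau^2\rho(1-\sigma)^2},\qquad \alpha_2=\frac{2\,(f(x_0)-f^* )(1+\sigma)}{\tau(1-3\sigma)} .$$ Moreover, the best Frank-Wolfe gap satisfies $$g_N^*\le\frac{\tau}{1+\sigma}.$$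
   Context: The problem is $\min_{x\in C}f(x)$, and $f^*=\min_{x\in C}f(x)$. Frank-Wolfe algorithm with inexact gradient. Input: $x_0\in C$, $\tau>0$. For $n=0,1,2,\dots$: compute $\widetilde\nabla f(x_n)$; compute $\hat x_n\in\arg\min_{x\in C}\widetilde\nabla f(x_n)^\top(x-x_n)$; set $d_n=\hat x_n-x_n$; choose a step size $\eta_n\in(0,1]$; set $x_{n+1}=x_n+\eta_nd_n$; stop after this iteration if $-\widetilde\nabla f(x_n)^\top d_n\le\tau$. Upon stopping, $N$ denotes the index $n$ of the last iteration performed (iterations are numbered from $0$). Notation: $\tilde g_n=-\widetilde\nabla f(x_n)^\top d_n$. The (exact) Frank-Wolfe gap is $g_n^{FW}=-\min_{x\in C}\nabla f(x_n)^\top(x-x_n)\ge0$, and the best Frank-Wolfe gap along iterations $0,\dots,N$ is $g_N^*=\min_{0\le i\le N}g_i^{FW}$.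
   Formalization: For σ>0 the gap bound τ/(1+σ) can fail; proved instead: g*_N ≤ (1+2σ)τ/(1+σ) always, and g*_N ≤ τ/(1+σ) if N=⌈max{α1,α2}⌉−1 or g̃_N ≤ (1−σ)τ/(1+σ). The bound on N is stated for f(x0)≠f*; if f(x0)=f*, then N=0. *)

theory Defs
  imports "HOL-Analysis.Analysis"
begin

text \<open>
  \<open>gradf\<close> is the exact gradient, \<open>G\<close> its estimate, and \<open>x, xhat, \<eta>\<close> are the
  sequences produced by the algorithm.  Infima over a compact convex set \<open>C\<close> of continuous functions
  are attained, so \<open>INF\<close> stands for the minimum.
\<close>

definition fw_dir :: "(nat \<Rightarrow> 'a::euclidean_space) \<Rightarrow> (nat \<Rightarrow> 'a) \<Rightarrow> nat \<Rightarrow> 'a" where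
  "fw_dir x xhat n = xhat n - x n"

definition fw_inexact_gap ::
  "('a::euclidean_space \<Rightarrow> 'a) \<Rightarrow> (nat \<Rightarrow> 'a) \<Rightarrow> (nat \<Rightarrow> 'a) \<Rightarrow> nat \<Rightarrow> real" where
  "fw_inexact_gap G x xhat n = - (G (x n) \<bullet> fw_dir x xhat n)"

definition fw_gap :: "('a::euclidean_space \<Rightarrow> 'a) \<Rightarrow> 'a set \<Rightarrow> 'a \<Rightarrow> real" where
  "fw_gap gradf C y = - (INF z\<in>C. gradf y \<bullet> (z - y))"

definition fw_best_gap ::
  "('a::euclidean_space \<Rightarrow> 'a) \<Rightarrow> 'a set \<Rightarrow> (nat \<Rightarrow> 'a) \<Rightarrow> nat \<Rightarrow> real" where
  "fw_best_gap gradf C x N = Min ((\<lambda>i. fw_gap gradf C (x i)) ` {0..N})"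

text \<open>
  Iteration \<open>n\<close> is performed iff the stopping test failed in all earlier iterations.  The sequences
  are total functions on \<open>nat\<close>, but they are constrained only at performed iterations; the values
  after stopping are irrelevant.
\<close>

definition fw_performed ::
  "('a::euclidean_space \<Rightarrow> 'a) \<Rightarrow> real \<Rightarrow> (nat \<Rightarrow> 'a) \<Rightarrow> (nat \<Rightarrow> 'a) \<Rightarrow> nat \<Rightarrow> bool" where
  "fw_performed G \<tau> x xhat n \<longleftrightarrow> (\<forall>m<n. \<not> fw_inexact_gap G x xhat m \<le> \<tau>)"

definition fw_last_iteration ::
  "('a::euclidean_space \<Rightarrow> 'a) \<Rightarrow> real \<Rightarrow> (nat \<Rightarrow> 'a) \<Rightarrow> (nat \<Rightarrow> 'a) \<Rightarrow> nat \<Rightarrow> bool" where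
  "fw_last_iteration G \<tau> x xhat N \<longleftrightarrow>
     fw_performed G \<tau> x xhat N \<and> fw_inexact_gap G x xhat N \<le> \<tau>"

definition fw_run ::
  "'a::euclidean_space set \<Rightarrow> ('a \<Rightarrow> 'a) \<Rightarrow> real \<Rightarrow> 'a \<Rightarrow>
   (nat \<Rightarrow> 'a) \<Rightarrow> (nat \<Rightarrow> 'a) \<Rightarrow> (nat \<Rightarrow> real) \<Rightarrow> bool" where
  "fw_run C G \<tau> x0 x xhat \<eta> \<longleftrightarrow>
     x 0 = x0 \<and>
     (\<forall>n. fw_performed G \<tau> x xhat n \<longrightarrow>
        is_arg_min (\<lambda>z. G (x n) \<bullet> (z - x n)) (\<lambda>z. z \<in> C) (xhat n) \<and>
        0 < \<eta> n \<and> \<eta> n \<le> 1 \<and>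
        x (Suc n) = x n + \<eta> n *\<^sub>R fw_dir x xhat n)"

text \<open>
  If \<open>fw_dir x xhat n = 0\<close>, the quotient is \<open>0 / 0 = 0\<close>; the inexact gap is then 0 as well, so this
  can only happen in the last iteration.
\<close>

definition fw_step_bound ::
  "real \<Rightarrow> ('a::euclidean_space \<Rightarrow> 'a) \<Rightarrow> (nat \<Rightarrow> 'a) \<Rightarrow> (nat \<Rightarrow> 'a) \<Rightarrow> nat \<Rightarrow> real" where
  "fw_step_bound L G x xhat n =
     min 1 (fw_inexact_gap G x xhat n / (L * (norm (fw_dir x xhat n))\<^sup>2))"

end

theory Submission
  imports Defs
begin

text \<open>
  Every iteration whose inexact gap exceeds the threshold \<open>\<theta> = (1 - \<sigma>) / (1 + \<sigma>) * \<tau>\<close> decreases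
  \<open>f\<close> by more than a fixed amount, and the total decrease cannot exceed \<open>f x0 - fstar\<close>; this bounds
  the number of such iterations.  Two mechanisms give the decrease.  If the step bound is below 1, it
  equals the inexact gap divided by \<open>L\<close> times the squared length of the direction, so the assumed
  sufficient decrease is quadratic in the gap; this yields \<open>\<alpha>1\<close>.  If the step bound is 1, the
  iteration takes the full step and the descent lemma applies: half of the inexact gap is gained, and
  the error \<open>\<sigma> / (1 + \<sigma>) * \<tau>\<close> of the gradient estimate is lost.  At the threshold the balance is
  \<open>\<tau> * (1 - 3 * \<sigma>) / (2 * (1 + \<sigma>))\<close>, which yields \<open>\<alpha>2\<close> and is positive exactly because
  \<open>\<sigma> < 1/3\<close>.  Lemma \<open>iteration_count_less\<close> is this count.

  The count is used twice.  All iterations before the last one have an inexact gap above \<open>\<tau>\<close>, hence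
  above \<open>\<theta>\<close>, so if there are any, they are fewer than \<open>max \<alpha>1 \<alpha>2\<close>.  For the best Frank-Wolfe gap,
  note that an exact gap exceeds the inexact one by at most the gradient error (lemma
  \<open>fw_gap_le_inexact_gap\<close>), and that \<open>\<theta>\<close> plus this error is exactly \<open>\<tau> / (1 + \<sigma>)\<close>.  Thus if
  the best gap were larger than \<open>\<tau> / (1 + \<sigma>)\<close>, then every iteration, also the last one,
  would have an inexact gap above \<open>\<theta>\<close>, and the count would apply to all \<open>N + 1\<close> iterations; this
  excludes \<open>N + 1 = \<lceil>max \<alpha>1 \<alpha>2\<rceil>\<close>.  For smaller \<open>N\<close> the stopping test alone gives the weaker bound
  \<open>(1 + 2 * \<sigma>) / (1 + \<sigma>) * \<tau>\<close>, which is \<open>\<tau>\<close> plus the error.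
\<close>

section \<open>Smooth functions along a step\<close>

text \<open>
  The descent lemma: subtracting the quadratic upper model from \<open>f\<close> along the segment leaves a
  function whose derivative is nonpositive by the Lipschitz bound, so no integration is necessary.
\<close>

lemma lipschitz_gradient_quadratic_bound:
  fixes f :: "'a::euclidean_space \<Rightarrow> real"
  assumes grad: "\<And>y. GDERIV f y :> gradf y" and lip: "L-lipschitz_on UNIV gradf"
  shows "f (y + d) \<le> f y + gradf y \<bullet> d + L / 2 * (norm d)\<^sup>2"
proof -
  define \<phi> where "\<phi> t = f (y + t *\<^sub>R d) - t * (gradf y \<bullet> d) - L / 2 * t\<^sup>2 * (norm d)\<^sup>2" for t
  have der: "(\<phi> has_real_derivative
      (gradf (y + t *\<^sub>R d) - gradf y) \<bullet> d - L * t * (norm d)\<^sup>2) (at t)" for t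
  proof -
    have line: "((\<lambda>t. y + t *\<^sub>R d) has_derivative (\<lambda>h. h *\<^sub>R d)) (at t)"
      by (auto intro!: derivative_eq_intros)
    have "(f has_derivative (\<lambda>h. h \<bullet> gradf (y + t *\<^sub>R d))) (at (y + t *\<^sub>R d))"
      using grad[of "y + t *\<^sub>R d"] by (simp add: gderiv_def)
    from has_derivative_compose[OF line this]
    have "((\<lambda>t. f (y + t *\<^sub>R d)) has_real_derivative gradf (y + t *\<^sub>R d) \<bullet> d) (at t)"
      by (simp add: has_field_derivative_def inner_commute mult_commute_abs)
    then show ?thesis
      unfolding \<phi>_def
      by (auto intro!: derivative_eq_intros simp: inner_diff_left algebra_simps)
  qed
  have "\<phi> 1 \<le> \<phi> 0"
  proof (rule DERIV_nonpos_imp_nonincreasing[of 0 1 \<phi>])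
    fix t :: real assume t: "0 \<le> t" "t \<le> 1"
    have "(gradf (y + t *\<^sub>R d) - gradf y) \<bullet> d \<le> norm (gradf (y + t *\<^sub>R d) - gradf y) * norm d"
      by (rule norm_cauchy_schwarz)
    also have "\<dots> \<le> (L * norm (t *\<^sub>R d)) * norm d"
      using lipschitz_onD[OF lip, of "y + t *\<^sub>R d" y]
      by (intro mult_right_mono) (simp_all add: dist_norm)
    also have "\<dots> = L * t * (norm d)\<^sup>2"
      using t by (simp add: power2_eq_square)
    finally show "\<exists>D. (\<phi> has_real_derivative D) (at t) \<and> D \<le> 0"
      using der by (intro exI[of _ "(gradf (y + t *\<^sub>R d) - gradf y) \<bullet> d - L * t * (norm d)\<^sup>2"]) simp
  qed simp
  then show ?thesis
    by (simp add: \<phi>_def)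
qed

lemma steady_decrease_less:
  fixes u :: "nat \<Rightarrow> real"
  assumes "0 < m" and "\<And>n. n < m \<Longrightarrow> \<delta> < u n - u (Suc n)"
  shows "real m * \<delta> < u 0 - u m"
  using assms
proof (induction m rule: nat_induct_non_zero)
  case 1
  then show ?case by simp
next
  case (Suc m)
  then have "real m * \<delta> < u 0 - u m" and "\<delta> < u m - u (Suc m)"
    by auto
  then show ?case
    by (simp add: algebra_simps)
qed

lemma fw_performed_antimono:
  "fw_performed G \<tau> x xhat n \<Longrightarrow> m \<le> n \<Longrightarrow> fw_performed G \<tau> x xhat m"
  by (auto simp: fw_performed_def)

lemma fw_last_iteration_unique:
  "fw_last_iteration G \<tau> x xhat m \<Longrightarrow> fw_last_iteration G \<tau> x xhat n \<Longrightarrow> m = n"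
  by (metis fw_last_iteration_def fw_performed_def linorder_neqE_nat)

section \<open>Decrease along an inexact Frank-Wolfe run\<close>

locale inexact_frank_wolfe =
  fixes C :: "'a::euclidean_space set"
    and f :: "'a \<Rightarrow> real" and gradf G :: "'a \<Rightarrow> 'a"
    and L \<tau> \<sigma> \<rho> :: real
    and x0 :: 'a and x xhat :: "nat \<Rightarrow> 'a" and \<eta> :: "nat \<Rightarrow> real"
  assumes convex: "convex C" and compact: "compact C" and diameter_pos: "diameter C > 0"
    and gradient: "\<And>y. GDERIV f y :> gradf y"
    and L_pos: "L > 0" and lipschitz: "L-lipschitz_on UNIV gradf"
    and \<tau>_pos: "\<tau> > 0" and \<sigma>_nonneg: "0 \<le> \<sigma>" and \<sigma>_less: "\<sigma> < 1/3"
    and gradient_error: "\<And>y xbar. y \<in> C \<Longrightarrow> xbar \<in> C \<Longrightarrow>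
           \<bar>(gradf xbar - G xbar) \<bullet> (y - xbar)\<bar> \<le> \<sigma> / (1 + \<sigma>) * \<tau>"
    and start: "x0 \<in> C" and run: "fw_run C G \<tau> x0 x xhat \<eta>"
    and \<rho>_pos: "\<rho> > 0"
    and step_ge: "\<And>n. fw_performed G \<tau> x xhat n \<Longrightarrow> \<eta> n \<ge> fw_step_bound L G x xhat n"
    and sufficient_decrease: "\<And>n. fw_performed G \<tau> x xhat n \<Longrightarrow>
           f (x n) - f (x n + \<eta> n *\<^sub>R fw_dir x xhat n)
             \<ge> \<rho> * fw_step_bound L G x xhat n * fw_inexact_gap G x xhat n"
begin

abbreviation performed :: "nat \<Rightarrow> bool" where
  "performed \<equiv> fw_performed G \<tau> x xhat"

abbreviation inexact_gap :: "nat \<Rightarrow> real" where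
  "inexact_gap \<equiv> fw_inexact_gap G x xhat"

abbreviation dir :: "nat \<Rightarrow> 'a" where
  "dir \<equiv> fw_dir x xhat"

lemma x_Suc: "performed n \<Longrightarrow> x (Suc n) = x n + \<eta> n *\<^sub>R dir n"
  and step_in_unit: "performed n \<Longrightarrow> 0 < \<eta> n" "performed n \<Longrightarrow> \<eta> n \<le> 1"
  and xhat_in: "performed n \<Longrightarrow> xhat n \<in> C"
  and xhat_minimal: "performed n \<Longrightarrow> z \<in> C \<Longrightarrow> - (G (x n) \<bullet> (z - x n)) \<le> inexact_gap n"
  using run by (auto simp: fw_run_def is_arg_min_linorder fw_inexact_gap_def fw_dir_def)

lemma Suc_iterate_in: "performed n \<Longrightarrow> x n \<in> C \<Longrightarrow> x (Suc n) \<in> C"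
  using convexD_alt[OF convex, of "x n" "xhat n" "\<eta> n"] xhat_in[of n] step_in_unit[of n]
  by (simp add: x_Suc fw_dir_def algebra_simps)

lemma iterate_in: "performed n \<Longrightarrow> x n \<in> C"
proof (induction n)
  case 0
  then show ?case using run start by (simp add: fw_run_def)
next
  case (Suc n)
  then show ?case
    using Suc_iterate_in fw_performed_antimono[of G \<tau> x xhat "Suc n" n] by simp
qed

lemma norm_dir_le_diameter: "performed n \<Longrightarrow> norm (dir n) \<le> diameter C"
  using diameter_bounded_bound[OF compact_imp_bounded[OF compact] xhat_in iterate_in, of n n]
  by (simp add: fw_dir_def dist_norm)

lemma Inf_le_f:
  assumes "z \<in> C"
  shows "(INF z\<in>C. f z) \<le> f z"
proof (rule cINF_lower[OF _ assms])
  have "continuous_on C f"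
    using gradient unfolding gderiv_def
    by (meson continuous_at_imp_continuous_on has_derivative_continuous)
  then show "bdd_below (f ` C)"
    using compact by (intro bounded_imp_bdd_below compact_imp_bounded compact_continuous_image)
qed

text \<open>
  In each direction of \<open>C\<close> the exact and the estimated slope differ by at most the gradient error,
  hence so do their minima over \<open>C\<close>.
\<close>

lemma fw_gap_le_inexact_gap:
  assumes "performed n"
  shows "fw_gap gradf C (x n) \<le> inexact_gap n + \<sigma> / (1 + \<sigma>) * \<tau>"
proof -
  have "- (inexact_gap n + \<sigma> / (1 + \<sigma>) * \<tau>) \<le> (INF z\<in>C. gradf (x n) \<bullet> (z - x n))"
  proof (rule cINF_greatest)
    fix z assume z: "z \<in> C"
    from gradient_error[OF z iterate_in[OF assms]] xhat_minimal[OF assms z]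
    show "- (inexact_gap n + \<sigma> / (1 + \<sigma>) * \<tau>) \<le> gradf (x n) \<bullet> (z - x n)"
      by (simp add: inner_diff_left abs_le_iff)
  qed (use start in blast)
  then show ?thesis
    by (simp add: fw_gap_def)
qed

lemma full_step_decrease:
  assumes perf: "performed n" and full: "fw_step_bound L G x xhat n = 1"
  shows "inexact_gap n / 2 - \<sigma> / (1 + \<sigma>) * \<tau> \<le> f (x n) - f (x (Suc n))"
proof -
  have "\<eta> n = 1"
    using step_ge[OF perf] step_in_unit[OF perf] full by simp
  then have step: "x (Suc n) = x n + dir n"
    using x_Suc[OF perf] by simp
  have quotient: "1 \<le> inexact_gap n / (L * (norm (dir n))\<^sup>2)"
    using full by (simp add: fw_step_bound_def min_def split: if_splits)
  \<comment> \<open>The quotient would be 0 for the zero direction, so the denominator is positive.\<close>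
  then have "dir n \<noteq> 0"
    by auto
  then have "L * (norm (dir n))\<^sup>2 \<le> inexact_gap n"
    using quotient L_pos by (simp add: le_divide_eq)
  moreover have "f (x n + dir n) \<le> f (x n) + gradf (x n) \<bullet> dir n + L / 2 * (norm (dir n))\<^sup>2"
    by (rule lipschitz_gradient_quadratic_bound[OF gradient lipschitz])
  moreover have "gradf (x n) \<bullet> dir n \<le> - inexact_gap n + \<sigma> / (1 + \<sigma>) * \<tau>"
    using gradient_error[OF xhat_in[OF perf] iterate_in[OF perf]]
    by (simp add: fw_inexact_gap_def fw_dir_def inner_diff_left abs_le_iff)
  ultimately show ?thesis
    by (simp add: step)
qed

lemma short_step_decrease:
  assumes perf: "performed n" and short: "fw_step_bound L G x xhat n \<noteq> 1"
    and pos: "0 < inexact_gap n"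
  shows "\<rho> * (inexact_gap n)\<^sup>2 / (L * (diameter C)\<^sup>2) \<le> f (x n) - f (x (Suc n))"
proof -
  have bound: "fw_step_bound L G x xhat n = inexact_gap n / (L * (norm (dir n))\<^sup>2)"
    using short by (simp add: fw_step_bound_def min_def split: if_splits)
  have "dir n \<noteq> 0"
    using pos by (auto simp: fw_inexact_gap_def)
  then have "\<rho> * (inexact_gap n)\<^sup>2 / (L * (diameter C)\<^sup>2)
      \<le> \<rho> * (inexact_gap n)\<^sup>2 / (L * (norm (dir n))\<^sup>2)"
    using norm_dir_le_diameter[OF perf] L_pos \<rho>_pos diameter_pos
    by (intro divide_left_mono mult_left_mono power_mono) auto
  also have "\<dots> = \<rho> * fw_step_bound L G x xhat n * inexact_gap n"
    by (simp add: bound power2_eq_square)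
  also have "\<dots> \<le> f (x n) - f (x (Suc n))"
    using sufficient_decrease[OF perf] x_Suc[OF perf] by simp
  finally show ?thesis .
qed

text \<open>
  The same count serves iterations that fail the stopping test at \<open>\<tau>\<close> and iterations whose exact
  gap exceeds \<open>\<tau> / (1 + \<sigma>)\<close>: the threshold is at most \<open>\<tau>\<close>, and adding the gradient error to it
  gives \<open>\<tau> / (1 + \<sigma>)\<close>.  For an optimal start the right-hand side is 0, so the conclusion is
  absurd, that is, already iteration 0 has a gap of at most the threshold.
\<close>

lemma iteration_count_less:
  defines "D \<equiv> f x0 - (INF z\<in>C. f z)"
  assumes m: "0 < m" and perf: "\<And>n. n < m \<Longrightarrow> performed n"
    and large: "\<And>n. n < m \<Longrightarrow> (1 - \<sigma>) / (1 + \<sigma>) * \<tau> < inexact_gap n"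
  shows "real m < max ((diameter C)\<^sup>2 * L * D * (1 + \<sigma>)\<^sup>2 / (\<tau>\<^sup>2 * \<rho> * (1 - \<sigma>)\<^sup>2))
                      (2 * D * (1 + \<sigma>) / (\<tau> * (1 - 3 * \<sigma>)))"
proof -
  define \<theta> where "\<theta> = (1 - \<sigma>) / (1 + \<sigma>) * \<tau>"
  define \<delta>1 where "\<delta>1 = \<rho> * \<theta>\<^sup>2 / (L * (diameter C)\<^sup>2)"
  define \<delta>2 where "\<delta>2 = \<theta> / 2 - \<sigma> / (1 + \<sigma>) * \<tau>"
  have \<theta>_pos: "0 < \<theta>"
    using \<sigma>_nonneg \<sigma>_less \<tau>_pos by (simp add: \<theta>_def)
  have \<delta>2_eq: "\<delta>2 = \<tau> * (1 - 3 * \<sigma>) / (2 * (1 + \<sigma>))"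
    using \<sigma>_nonneg unfolding \<delta>2_def \<theta>_def by (simp add: divide_simps) algebra
  have \<delta>_pos: "0 < \<delta>1" "0 < \<delta>2"
    using \<theta>_pos \<rho>_pos L_pos diameter_pos \<sigma>_nonneg \<sigma>_less \<tau>_pos by (simp_all add: \<delta>1_def \<delta>2_eq)
  have gap: "\<theta> < inexact_gap n" if "n < m" for n
    using large[OF that] by (simp add: \<theta>_def)
  have decrease: "min \<delta>1 \<delta>2 < f (x n) - f (x (Suc n))" if n: "n < m" for n
  proof (cases "fw_step_bound L G x xhat n = 1")
    case True
    from full_step_decrease[OF perf[OF n] True] gap[OF n] have "\<delta>2 < f (x n) - f (x (Suc n))"
      by (simp add: \<delta>2_def)
    then show ?thesis by simp
  next
    case False
    from gap[OF n] have "\<theta>\<^sup>2 < (inexact_gap n)\<^sup>2"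
      using \<theta>_pos by (intro power_strict_mono) auto
    then have "\<delta>1 < \<rho> * (inexact_gap n)\<^sup>2 / (L * (diameter C)\<^sup>2)"
      unfolding \<delta>1_def using \<rho>_pos L_pos diameter_pos
      by (intro divide_strict_right_mono mult_strict_left_mono) auto
    also have "\<dots> \<le> f (x n) - f (x (Suc n))"
      using short_step_decrease[OF perf[OF n] False] gap[OF n] \<theta>_pos by simp
    finally show ?thesis by simp
  qed
  have "x m \<in> C"
    using m perf Suc_iterate_in iterate_in by (cases m) auto
  then have "f (x 0) - f (x m) \<le> D"
    using Inf_le_f[of "x m"] run by (simp add: D_def fw_run_def)
  with steady_decrease_less[of m "min \<delta>1 \<delta>2" "\<lambda>n. f (x n)", OF m decrease]
  have "real m * min \<delta>1 \<delta>2 < D"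
    by simp
  then have "real m < max (D / \<delta>1) (D / \<delta>2)"
    using \<delta>_pos by (auto simp: min_def less_max_iff_disj pos_less_divide_eq split: if_splits)
  moreover have "D / \<delta>1 = (diameter C)\<^sup>2 * L * D * (1 + \<sigma>)\<^sup>2 / (\<tau>\<^sup>2 * \<rho> * (1 - \<sigma>)\<^sup>2)"
    by (simp add: \<delta>1_def \<theta>_def power_mult_distrib power_divide mult_ac)
  moreover have "D / \<delta>2 = 2 * D * (1 + \<sigma>) / (\<tau> * (1 - 3 * \<sigma>))"
    by (simp add: \<delta>2_eq mult_ac)
  ultimately show ?thesis
    by simp
qed

end

section \<open>Termination and the best gap\<close>

theorem theorem3p1:
  fixes C :: "'a::euclidean_space set"
    and f :: "'a \<Rightarrow> real" and gradf G :: "'a \<Rightarrow> 'a"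
    and L \<tau> \<sigma> \<rho> :: real
    and x0 :: 'a and x xhat :: "nat \<Rightarrow> 'a" and \<eta> :: "nat \<Rightarrow> real"
  assumes "C \<noteq> {}" and "convex C" and "compact C" and "diameter C > 0"
    and "\<And>y. GDERIV f y :> gradf y" and "L > 0" and "L-lipschitz_on UNIV gradf"
    and "\<tau> > 0" and "0 \<le> \<sigma>" and "\<sigma> < 1/3"
    and "\<And>y xbar. y \<in> C \<Longrightarrow> xbar \<in> C \<Longrightarrow>
           \<bar>(gradf xbar - G xbar) \<bullet> (y - xbar)\<bar> \<le> \<sigma> / (1 + \<sigma>) * \<tau>"
    and "x0 \<in> C" and "fw_run C G \<tau> x0 x xhat \<eta>"
    and "\<rho> > 0"
    and "\<And>n. fw_performed G \<tau> x xhat n \<Longrightarrow> \<eta> n \<ge> fw_step_bound L G x xhat n"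
    and "\<And>n. fw_performed G \<tau> x xhat n \<Longrightarrow>
           f (x n) - f (x n + \<eta> n *\<^sub>R fw_dir x xhat n)
             \<ge> \<rho> * fw_step_bound L G x xhat n * fw_inexact_gap G x xhat n"
  shows "let fstar = (INF z\<in>C. f z);
             \<alpha>1 = (diameter C)\<^sup>2 * L * (f x0 - fstar) * (1 + \<sigma>)\<^sup>2 / (\<tau>\<^sup>2 * \<rho> * (1 - \<sigma>)\<^sup>2);
             \<alpha>2 = 2 * (f x0 - fstar) * (1 + \<sigma>) / (\<tau> * (1 - 3 * \<sigma>))
         in \<exists>!N. fw_last_iteration G \<tau> x xhat N
              \<and> (f x0 \<noteq> fstar \<longrightarrow> int N \<le> \<lceil>max \<alpha>1 \<alpha>2\<rceil> - 1)
              \<and> (f x0 = fstar \<longrightarrow> N = 0)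
              \<and> fw_best_gap gradf C x N \<le> (1 + 2 * \<sigma>) / (1 + \<sigma>) * \<tau>
              \<and> (int N = \<lceil>max \<alpha>1 \<alpha>2\<rceil> - 1
                    \<or> fw_inexact_gap G x xhat N \<le> (1 - \<sigma>) / (1 + \<sigma>) * \<tau>
                 \<longrightarrow> fw_best_gap gradf C x N \<le> \<tau> / (1 + \<sigma>))"
proof -
  interpret inexact_frank_wolfe C f gradf G L \<tau> \<sigma> \<rho> x0 x xhat \<eta>
    using assms by unfold_locales
  define D where "D = f x0 - (INF z\<in>C. f z)"
  define M where "M = max ((diameter C)\<^sup>2 * L * D * (1 + \<sigma>)\<^sup>2 / (\<tau>\<^sup>2 * \<rho> * (1 - \<sigma>)\<^sup>2))
                          (2 * D * (1 + \<sigma>) / (\<tau> * (1 - 3 * \<sigma>)))"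
  have count: "real m < M"
    if "0 < m" "\<And>n. n < m \<Longrightarrow> performed n"
      "\<And>n. n < m \<Longrightarrow> (1 - \<sigma>) / (1 + \<sigma>) * \<tau> < inexact_gap n" for m
    using iteration_count_less[OF that] by (simp add: M_def D_def)
  have threshold_le: "(1 - \<sigma>) / (1 + \<sigma>) * \<tau> \<le> \<tau>"
    using \<sigma>_nonneg \<tau>_pos by (simp add: field_simps)
  have performed_count: "real m < M" if "0 < m" "performed m" for m
  proof (rule count[OF \<open>0 < m\<close>])
    fix n assume "n < m"
    with \<open>performed m\<close> show "performed n"
      by (simp add: fw_performed_antimono)
    from \<open>n < m\<close> \<open>performed m\<close> show "(1 - \<sigma>) / (1 + \<sigma>) * \<tau> < inexact_gap n"
      using threshold_le by (fastforce simp: fw_performed_def)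
  qed
  have "\<exists>n. inexact_gap n \<le> \<tau>"
  proof (rule ccontr)
    assume "\<nexists>n. inexact_gap n \<le> \<tau>"
    then have "performed n" for n
      by (auto simp: fw_performed_def)
    then have "real (Suc n) < M" for n
      by (intro performed_count) auto
    moreover obtain n where "M \<le> real n"
      using real_arch_simple by blast
    ultimately show False
      by (smt (verit) of_nat_Suc)
  qed
  define N where "N = (LEAST n. inexact_gap n \<le> \<tau>)"
  have last: "fw_last_iteration G \<tau> x xhat N"
    using \<open>\<exists>n. inexact_gap n \<le> \<tau>\<close> not_less_Least
    unfolding fw_last_iteration_def fw_performed_def N_def by (auto intro: LeastI_ex)
  then have perf: "performed N" and stop: "inexact_gap N \<le> \<tau>"
    by (simp_all add: fw_last_iteration_def)
  have M_pos: "0 < M" if "f x0 \<noteq> (INF z\<in>C. f z)"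
  proof -
    have "0 < D"
      using Inf_le_f[OF start] that by (simp add: D_def)
    then have "0 < 2 * D * (1 + \<sigma>) / (\<tau> * (1 - 3 * \<sigma>))"
      using \<sigma>_nonneg \<sigma>_less \<tau>_pos by simp
    then show ?thesis
      by (simp add: M_def less_max_iff_disj)
  qed
  have bound: "int N \<le> \<lceil>M\<rceil> - 1" if "f x0 \<noteq> (INF z\<in>C. f z)"
  proof -
    have "real N < M"
      using M_pos[OF that] performed_count[OF _ perf] by (cases "N = 0") auto
    then show ?thesis
      by linarith
  qed
  have optimal_start: "N = 0" if "f x0 = (INF z\<in>C. f z)"
  proof -
    have "M = 0"
      using that by (simp add: M_def D_def)
    then show ?thesis
      using performed_count[OF _ perf] by fastforce
  qed
  have best_le: "fw_best_gap gradf C x N \<le> inexact_gap i + \<sigma> / (1 + \<sigma>) * \<tau>" if "i \<le> N" for i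
  proof -
    have "fw_best_gap gradf C x N \<le> fw_gap gradf C (x i)"
      unfolding fw_best_gap_def using that by (intro Min_le) auto
    also have "\<dots> \<le> inexact_gap i + \<sigma> / (1 + \<sigma>) * \<tau>"
      using perf that by (intro fw_gap_le_inexact_gap) (rule fw_performed_antimono)
    finally show ?thesis .
  qed
  have "\<tau> + \<sigma> / (1 + \<sigma>) * \<tau> = (1 + 2 * \<sigma>) / (1 + \<sigma>) * \<tau>"
    using \<sigma>_nonneg by (simp add: field_simps)
  then have weak: "fw_best_gap gradf C x N \<le> (1 + 2 * \<sigma>) / (1 + \<sigma>) * \<tau>"
    using best_le[of N] stop by simp
  have threshold_plus_error: "(1 - \<sigma>) / (1 + \<sigma>) * \<tau> + \<sigma> / (1 + \<sigma>) * \<tau> = \<tau> / (1 + \<sigma>)"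
    by (simp add: add_divide_distrib[symmetric] left_diff_distrib)
  have strong: "fw_best_gap gradf C x N \<le> \<tau> / (1 + \<sigma>)"
    if "int N = \<lceil>M\<rceil> - 1 \<or> inexact_gap N \<le> (1 - \<sigma>) / (1 + \<sigma>) * \<tau>"
  proof (rule ccontr)
    assume "\<not> ?thesis"
    then have large: "(1 - \<sigma>) / (1 + \<sigma>) * \<tau> < inexact_gap i" if "i \<le> N" for i
      using best_le[OF that] threshold_plus_error by linarith
    then have "real (Suc N) < M"
      using fw_performed_antimono[OF perf] by (intro count) auto
    moreover have "int N = \<lceil>M\<rceil> - 1"
      using that large[of N] by simp
    ultimately show False
      by linarith
  qed
  show ?thesis
    unfolding Let_def D_def[symmetric] M_def[symmetric]
  proof (rule ex1I[of _ N], intro conjI impI)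
    fix m assume "fw_last_iteration G \<tau> x xhat m \<and> (f x0 \<noteq> (INF z\<in>C. f z) \<longrightarrow> int m \<le> \<lceil>M\<rceil> - 1)
      \<and> (f x0 = (INF z\<in>C. f z) \<longrightarrow> m = 0)
      \<and> fw_best_gap gradf C x m \<le> (1 + 2 * \<sigma>) / (1 + \<sigma>) * \<tau>
      \<and> (int m = \<lceil>M\<rceil> - 1 \<or> inexact_gap m \<le> (1 - \<sigma>) / (1 + \<sigma>) * \<tau>
          \<longrightarrow> fw_best_gap gradf C x m \<le> \<tau> / (1 + \<sigma>))"
    then show "m = N"
      using last fw_last_iteration_unique by blast
  qed (use last bound optimal_start weak strong in blast)+
qed

end
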